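(* Let $G=(V,E)$ be a finite digraph and $p\geq 2$ an integer. Then $G$ has a nowhere-zero $p$-flow if and only if there exists a map $\psi:E\to\{0,1,\dots,p-2\}$ such that the number of even $\psi$-conformal dual $p$-flows on $G$ is not equal to the number of odd $\psi$-conformal dual $p$-flows on $G$.
   Context: $\mathbb{Z}_p=\{0,1,\dots,p-1\}$ denotes the additive group of integers modulo $p$. For a vertex $v$, $\delta^-(v)$ is the set of arcs with head $v$ and $\delta^+(v)$ the set of arcs with tail $v$. A $p$-flow on $G$ is a map $\phi:E\to\mathbb{Z}_p$ with $\sum_{e\in\delta^-(v)}\phi(e)-\sum_{e\in\delta^+(v)}\phi(e)=0$ in $\mathbb{Z}_p$ for every vertex $v$; it is nowhere-zero if $\phi(e)\neq 0$ for all $e$. A dual $p$-flow is a map $\phi:E\to\mathbb{Z}_p$ such that for every circuit (cycle) $C$ of the underlying undirected graph, traversed in one of its directions, the signed sum of $\phi(e)$ over $e\in C$ (with sign $+$ for arcs traversed along their orientation and $-$ for arcs traversed against it) is $0$ in $\mathbb{Z}_p$. A map $\phi:E\to\mathbb{Z}_p$ is even if $|\phi^{-1}(p-1)|$ is even, and odd otherwise. For $\psi:E\to\{0,\dots,p-2\}$, a map $\phi:E\to\mathbb{Z}_p$ is $\psi$-conformal if $\phi(e)\in\{\psi(e),p-1\}$ for every arc $e$. *)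

theory Defs
  imports "Graph_Theory.Graph_Theory" "HOL-Number_Theory.Cong" "HOL-Library.FuncSet"
begin

text \<open>
  Elements of \<open>\<int>\<^sub>p\<close> are represented by \<open>{0..<p}\<close>, with equations in \<open>\<int>\<^sub>p\<close> read as
  congruences modulo \<open>p\<close>.  Maps on the arc set are extensional, so that counting
  them counts maps on \<open>arcs G\<close> only.
\<close>

definition Zp_maps :: "('a, 'b) pre_digraph \<Rightarrow> int \<Rightarrow> ('b \<Rightarrow> int) set" where
  "Zp_maps G p = (arcs G \<rightarrow>\<^sub>E {0..<p})"

definition is_flow :: "('a, 'b) pre_digraph \<Rightarrow> int \<Rightarrow> ('b \<Rightarrow> int) \<Rightarrow> bool" where
  "is_flow G p \<phi> \<longleftrightarrow> \<phi> \<in> Zp_maps G p \<and>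
     (\<forall>v \<in> verts G. [(\<Sum>e \<in> in_arcs G v. \<phi> e) - (\<Sum>e \<in> out_arcs G v. \<phi> e) = 0] (mod p))"

definition nowhere_zero :: "('a, 'b) pre_digraph \<Rightarrow> ('b \<Rightarrow> int) \<Rightarrow> bool" where
  "nowhere_zero G \<phi> \<longleftrightarrow> (\<forall>e \<in> arcs G. \<phi> e \<noteq> 0)"

text \<open>
  The two possible traversals of an arc \<open>e\<close>: \<open>(e, True)\<close> runs along its orientation,
  \<open>(e, False)\<close> against it.
\<close>

definition traversals :: "('a, 'b) pre_digraph \<Rightarrow> ('a, 'b \<times> bool) pre_digraph" where
  "traversals G =
     \<lparr> verts = verts G,
       arcs = arcs G \<times> UNIV,
       tail = (\<lambda>(e, fwd). if fwd then tail G e else head G e),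
       head = (\<lambda>(e, fwd). if fwd then head G e else tail G e) \<rparr>"

text \<open>
  A circuit of the underlying undirected multigraph together with a direction (and a
  starting point).  A loop is a circuit of length 1 and two parallel or antiparallel arcs
  form one of length 2; distinctness of the underlying arcs rules out traversing a
  single arc forth and back.
\<close>

definition circuit :: "('a, 'b) pre_digraph \<Rightarrow> ('b \<times> bool) list \<Rightarrow> bool" where
  "circuit G C \<longleftrightarrow> pre_digraph.cycle (traversals G) C \<and> distinct (map fst C)"

definition is_dual_flow :: "('a, 'b) pre_digraph \<Rightarrow> int \<Rightarrow> ('b \<Rightarrow> int) \<Rightarrow> bool" where
  "is_dual_flow G p \<phi> \<longleftrightarrow> \<phi> \<in> Zp_maps G p \<and>
     (\<forall>C. circuit G C \<longrightarrow>
        [(\<Sum>(e, fwd) \<leftarrow> C. if fwd then \<phi> e else - \<phi> e) = 0] (mod p))"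

definition even_map :: "('a, 'b) pre_digraph \<Rightarrow> int \<Rightarrow> ('b \<Rightarrow> int) \<Rightarrow> bool" where
  "even_map G p \<phi> \<longleftrightarrow> even (card {e \<in> arcs G. \<phi> e = p - 1})"

abbreviation odd_map :: "('a, 'b) pre_digraph \<Rightarrow> int \<Rightarrow> ('b \<Rightarrow> int) \<Rightarrow> bool" where
  "odd_map G p \<phi> \<equiv> \<not> even_map G p \<phi>"

definition conformal :: "('a, 'b) pre_digraph \<Rightarrow> int \<Rightarrow> ('b \<Rightarrow> int) \<Rightarrow> ('b \<Rightarrow> int) \<Rightarrow> bool" where
  "conformal G p \<psi> \<phi> \<longleftrightarrow> (\<forall>e \<in> arcs G. \<phi> e \<in> {\<psi> e, p - 1})"

end

theory Submission
  imports Defs "HOL-Library.Real_Mod"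
begin

text \<open>
  Dual flows form a subgroup \<open>D\<close> of \<open>\<int>\<^sub>p\<^sup>E\<close>, namely the coboundaries of vertex potentials,
  and its orthogonal complement consists of the flows. The signed count of \<open>\<psi>\<close>-conformal
  dual flows is the sum over \<open>D\<close> of the product function with factors
  \<open>\<delta>\<^bsub>\<psi>(e)\<^esub> - \<delta>\<^bsub>p-1\<^esub>\<close>. On \<open>\<int>\<^sub>p\<close> the functions \<open>\<delta>\<^bsub>a\<^esub> - \<delta>\<^bsub>p-1\<^esub>\<close> span the functions of
  sum zero, and so do the nontrivial characters. Hence all signed counts vanish if and only if
  the sum over \<open>D\<close> of every product of nontrivial characters vanishes. Such a product is given
  by some \<open>k : E \<rightarrow> \<int>\<^sub>p \<setminus> {0}\<close>, and by orthogonality its sum over \<open>D\<close> is nonzero exactly when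
  \<open>k\<close> is a flow.
\<close>

subsection \<open>Closed walks\<close>

lemma not_distinct_mapE:
  assumes "\<not> distinct (map f xs)"
  obtains as x bs y cs where "xs = as @ x # bs @ y # cs" "f x = f y"
  using not_distinct_decomp[OF assms]
  by (fastforce simp: map_eq_append_conv append_eq_map_conv map_eq_Cons_conv Cons_eq_map_conv)

lemma (in pre_digraph) awalk_verts_eq_Cons_heads:
  "cas u C v \<Longrightarrow> awalk_verts u C = u # map (head G) C"
  by (induction C arbitrary: u) auto

lemma (in wf_digraph) cycle_iff_distinct_heads:
  "cycle C \<longleftrightarrow> (\<exists>u. awalk u C u) \<and> distinct (map (head G) C) \<and> C \<noteq> []"
proof -
  have "tl (awalk_verts u C) = map (head G) C" if "awalk u C u" for u
    using that awalk_verts_eq_Cons_heads[of u C u] by (simp add: awalk_def)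
  then show ?thesis by (auto simp: cycle_def)
qed

lemma (in wf_digraph) awalk_append_Cons_iff:
  "awalk u (C @ e # D) v \<longleftrightarrow>
    awalk u C (tail G e) \<and> e \<in> arcs G \<and> awalk (head G e) D v"
  by (induction C arbitrary: u) (auto simp: awalk_simps simp del: awalk_append_iff)

lemma (in wf_digraph) awalk_end_in_heads:
  assumes "awalk u C v" "C \<noteq> []"
  shows "v \<in> head G ` set C"
  using assms by (cases C rule: rev_cases)
    (auto simp: awalk_append_Cons_iff awalk_Nil_iff simp del: awalk_append_iff)

lemma (in wf_digraph) closed_awalk_induct [consumes 1, case_names Nil cycle splice]:
  assumes "awalk u C u"
    and "P []"
    and "\<And>C. cycle C \<Longrightarrow> P C"
    and splice: "\<And>A B C. P (A @ C) \<Longrightarrow> P B \<Longrightarrow> P (A @ B @ C)"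
  shows "P C"
  using assms(1)
proof (induction "length C" arbitrary: u C rule: less_induct)
  case less
  consider "C = []" | "cycle C" | (repeated_head) "\<not> distinct (map (head G) C)"
    using less.prems by (auto simp: cycle_iff_distinct_heads)
  then show ?case
  proof cases
    case repeated_head
    then obtain A x B y D where C: "C = A @ x # B @ y # D" and heads: "head G x = head G y"
      by (rule not_distinct_mapE)
    from less.prems have rest: "awalk u ((A @ [x]) @ D) u"
        and loop: "awalk (head G x) (B @ [y]) (head G x)"
      by (simp_all add: C heads awalk_append_Cons_iff awalk_Nil_iff del: awalk_append_iff)
    have "P ((A @ [x]) @ (B @ [y]) @ D)"
      by (intro splice less.hyps[OF _ rest] less.hyps[OF _ loop]) (simp_all add: C)
    then show ?thesis by (simp add: C)
  qed (simp_all add: assms)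
qed

subsection \<open>Walks in the underlying undirected graph\<close>

lemma traversals_simps [simp]:
  "verts (traversals G) = verts G"
  "arcs (traversals G) = arcs G \<times> UNIV"
  "tail (traversals G) x = (if snd x then tail G (fst x) else head G (fst x))"
  "head (traversals G) x = (if snd x then head G (fst x) else tail G (fst x))"
  by (simp_all add: traversals_def case_prod_beta)

lemma (in wf_digraph) wf_digraph_traversals: "wf_digraph (traversals G)"
  by unfold_locales auto

abbreviation undirected_walk ::
    "('a, 'b) pre_digraph \<Rightarrow> 'a \<Rightarrow> ('b \<times> bool) list \<Rightarrow> 'a \<Rightarrow> bool" where
  "undirected_walk G \<equiv> pre_digraph.awalk (traversals G)"

definition reverse_traversal :: "'b \<times> bool \<Rightarrow> 'b \<times> bool" where
  "reverse_traversal x = (fst x, \<not> snd x)"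

definition reverse_walk :: "('b \<times> bool) list \<Rightarrow> ('b \<times> bool) list" where
  "reverse_walk C = rev (map reverse_traversal C)"

lemma (in wf_digraph) undirected_walk_reverse_walk:
  assumes "undirected_walk G u C v"
  shows "undirected_walk G v (reverse_walk C) u"
proof -
  interpret T: wf_digraph "traversals G" by (rule wf_digraph_traversals)
  show ?thesis using assms
    by (induction C arbitrary: u)
      (auto simp: reverse_walk_def reverse_traversal_def T.awalk_simps T.awalk_append_Cons_iff
        simp del: T.awalk_append_iff)
qed

lemma (in wf_digraph) cycle_traversals_cases [consumes 1, case_names circuit backtrack]:
  assumes "pre_digraph.cycle (traversals G) C"
  obtains "circuit G C" | x where "C = [x, reverse_traversal x]"
proof (cases "distinct (map fst C)")
  case True
  then show thesis using assms that(1) by (simp add: circuit_def)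
next
  case False
  interpret T: wf_digraph "traversals G" by (rule wf_digraph_traversals)
  obtain u where walk: "T.awalk u C u" and heads: "distinct (map (head (traversals G)) C)"
    using assms by (auto simp: T.cycle_iff_distinct_heads)
  obtain A x B y D where C: "C = A @ x # B @ y # D" and "fst x = fst y"
    using False by (rule not_distinct_mapE)
  moreover have "x \<noteq> y" using heads by (auto simp: C)
  ultimately have y: "y = reverse_traversal x"
    by (auto simp: reverse_traversal_def prod_eq_iff)
  let ?s = "tail (traversals G) x" and ?t = "head (traversals G) x"
  have tail_y: "tail (traversals G) y = ?t" and head_y: "head (traversals G) y = ?s"
    by (simp_all add: y reverse_traversal_def)
  have A: "T.awalk u A ?s" and B: "T.awalk ?t B ?t" and D: "T.awalk ?s D u"
    using walk unfolding C
    by (simp_all add: T.awalk_append_Cons_iff tail_y head_y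
      del: T.awalk_append_iff traversals_simps)
  have "A = []"
    using T.awalk_end_in_heads[OF A] heads head_y unfolding C by force
  moreover have "B = []"
    using T.awalk_end_in_heads[OF B] heads unfolding C by force
  moreover have "D = []"
    using T.awalk_end_in_heads[OF D] heads head_y A \<open>A = []\<close> unfolding C
    by (force simp: T.awalk_Nil_iff)
  ultimately show thesis by (intro that(2)) (simp add: C y)
qed

subsection \<open>Dual flows and potentials\<close>

definition traversal_value :: "('b \<Rightarrow> 'c::ab_group_add) \<Rightarrow> 'b \<times> bool \<Rightarrow> 'c" where
  "traversal_value \<phi> = (\<lambda>(e, fwd). if fwd then \<phi> e else - \<phi> e)"

definition signed_sum :: "('b \<Rightarrow> 'c::ab_group_add) \<Rightarrow> ('b \<times> bool) list \<Rightarrow> 'c" where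
  "signed_sum \<phi> C = sum_list (map (traversal_value \<phi>) C)"

definition coboundary :: "('a, 'b) pre_digraph \<Rightarrow> ('a \<Rightarrow> 'c::ab_group_add) \<Rightarrow> 'b \<Rightarrow> 'c" where
  "coboundary G \<pi> e = \<pi> (head G e) - \<pi> (tail G e)"

lemma signed_sum_simps [simp]:
  "signed_sum \<phi> [] = 0"
  "signed_sum \<phi> (x # C) = traversal_value \<phi> x + signed_sum \<phi> C"
  "signed_sum \<phi> (C @ D) = signed_sum \<phi> C + signed_sum \<phi> D"
  by (simp_all add: signed_sum_def)

lemma traversal_value_reverse_traversal [simp]:
  "traversal_value \<phi> (reverse_traversal x) = - traversal_value \<phi> x"
  by (simp add: traversal_value_def reverse_traversal_def case_prod_beta)

lemma signed_sum_reverse_walk: "signed_sum \<phi> (reverse_walk C) = - signed_sum \<phi> C"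
  by (induction C) (simp_all add: reverse_walk_def)

lemma is_dual_flow_iff_dvd_circuits:
  "is_dual_flow G p \<phi> \<longleftrightarrow> \<phi> \<in> Zp_maps G p \<and> (\<forall>C. circuit G C \<longrightarrow> p dvd signed_sum \<phi> C)"
  by (simp add: is_dual_flow_def signed_sum_def traversal_value_def cong_0_iff)

lemma (in wf_digraph) dvd_signed_sum_closed_walk:
  fixes p :: "'c::comm_ring_1"
  assumes circuits: "\<forall>C. circuit G C \<longrightarrow> p dvd signed_sum \<phi> C"
    and walk: "undirected_walk G u C u"
  shows "p dvd signed_sum \<phi> C"
proof -
  interpret T: wf_digraph "traversals G" by (rule wf_digraph_traversals)
  from walk show ?thesis
  proof (induction rule: T.closed_awalk_induct)
    case (cycle C)
    then show ?case by (cases rule: cycle_traversals_cases) (simp_all add: circuits)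
  next
    case (splice A B C)
    then have "p dvd signed_sum \<phi> (A @ C) + signed_sum \<phi> B" by (rule dvd_add)
    then show ?case by (simp add: ac_simps)
  qed simp
qed

lemma (in wf_digraph) cong_signed_sum_if_same_ends:
  fixes p :: "'c::unique_euclidean_ring"
  assumes circuits: "\<forall>C. circuit G C \<longrightarrow> p dvd signed_sum \<phi> C"
    and walks: "undirected_walk G u C v" "undirected_walk G u D v"
  shows "[signed_sum \<phi> C = signed_sum \<phi> D] (mod p)"
proof -
  interpret T: wf_digraph "traversals G" by (rule wf_digraph_traversals)
  have "undirected_walk G u (C @ reverse_walk D) u"
    using walks(1) undirected_walk_reverse_walk[OF walks(2)] by (rule T.awalk_appendI)
  then have "p dvd signed_sum \<phi> (C @ reverse_walk D)"
    by (rule dvd_signed_sum_closed_walk[OF circuits])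
  then show ?thesis by (simp add: signed_sum_reverse_walk cong_iff_dvd_diff)
qed

lemma (in wf_digraph) potential_exists:
  fixes p :: "'c::unique_euclidean_ring"
  assumes circuits: "\<forall>C. circuit G C \<longrightarrow> p dvd signed_sum \<phi> C"
  obtains \<pi> where "\<And>e. e \<in> arcs G \<Longrightarrow> [\<phi> e = coboundary G \<pi> e] (mod p)"
proof -
  interpret T: wf_digraph "traversals G" by (rule wf_digraph_traversals)
  define root where "root v = (SOME u. \<exists>C. undirected_walk G u C v)" for v
  define path where "path v = (SOME C. undirected_walk G (root v) C v)" for v
  have path: "undirected_walk G (root v) (path v) v" if "v \<in> verts G" for v
  proof -
    have "undirected_walk G v [] v" using that by (simp add: T.awalk_Nil_iff)
    then have "\<exists>u C. undirected_walk G u C v" by blast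
    then have "\<exists>C. undirected_walk G (root v) C v" unfolding root_def by (rule someI_ex)
    then show ?thesis unfolding path_def by (rule someI_ex)
  qed
  have "[\<phi> e = coboundary G (\<lambda>v. signed_sum \<phi> (path v)) e] (mod p)" if e: "e \<in> arcs G" for e
  proof -
    have forward: "undirected_walk G (tail G e) [(e, True)] (head G e)"
      and backward: "undirected_walk G (head G e) [(e, False)] (tail G e)"
      using e by (auto simp: T.awalk_simps)
    have "(\<exists>C. undirected_walk G u C (tail G e)) \<longleftrightarrow>
        (\<exists>C. undirected_walk G u C (head G e))" for u
      using forward backward T.awalk_appendI by meson
    then have same_root: "root (tail G e) = root (head G e)" by (simp add: root_def)
    have "undirected_walk G (root (head G e)) (path (tail G e) @ [(e, True)]) (head G e)"
      using path[OF tail_in_verts[OF e]] forward unfolding same_root by (rule T.awalk_appendI)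
    from cong_signed_sum_if_same_ends[OF circuits this path[OF head_in_verts[OF e]]]
    have "[signed_sum \<phi> (path (tail G e)) + \<phi> e = signed_sum \<phi> (path (head G e))] (mod p)"
      by (simp add: traversal_value_def)
    then show ?thesis by (simp add: coboundary_def cong_iff_dvd_diff algebra_simps)
  qed
  then show ?thesis by (rule that)
qed

lemma (in wf_digraph) signed_sum_coboundary:
  assumes "undirected_walk G u C v"
  shows "signed_sum (coboundary G \<pi>) C = \<pi> v - \<pi> u"
proof -
  interpret T: wf_digraph "traversals G" by (rule wf_digraph_traversals)
  show ?thesis using assms
    by (induction C arbitrary: u)
      (auto simp: T.awalk_simps traversal_value_def coboundary_def case_prod_beta)
qed

lemma cong_signed_sum:
  fixes p :: "'c::unique_euclidean_ring"
  assumes "\<And>e. e \<in> fst ` set C \<Longrightarrow> [\<phi> e = \<phi>' e] (mod p)"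
  shows "[signed_sum \<phi> C = signed_sum \<phi>' C] (mod p)"
  using assms
  by (induction C) (auto simp: traversal_value_def case_prod_beta intro!: cong_add cong_diff)

theorem (in wf_digraph) is_dual_flow_iff_potential:
  "is_dual_flow G p \<phi> \<longleftrightarrow>
    \<phi> \<in> Zp_maps G p \<and> (\<exists>\<pi>. \<forall>e\<in>arcs G. [\<phi> e = coboundary G \<pi> e] (mod p))"
proof -
  have "p dvd signed_sum \<phi> C"
    if "circuit G C" and \<pi>: "\<forall>e\<in>arcs G. [\<phi> e = coboundary G \<pi> e] (mod p)" for C \<pi>
  proof -
    obtain u where u: "undirected_walk G u C u"
      using \<open>circuit G C\<close> by (auto simp: circuit_def pre_digraph.cycle_def)
    then have "fst ` set C \<subseteq> arcs G" by (auto simp: pre_digraph.awalk_def)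
    then have "[signed_sum \<phi> C = signed_sum (coboundary G \<pi>) C] (mod p)"
      using \<pi> by (intro cong_signed_sum) blast
    then show ?thesis by (simp add: signed_sum_coboundary[OF u] cong_0_iff)
  qed
  then show ?thesis
    unfolding is_dual_flow_iff_dvd_circuits by (metis potential_exists)
qed

definition reduce_mod :: "('a, 'b) pre_digraph \<Rightarrow> int \<Rightarrow> ('b \<Rightarrow> int) \<Rightarrow> 'b \<Rightarrow> int" where
  "reduce_mod G p f = (\<lambda>e\<in>arcs G. f e mod p)"

lemma cong_reduce_mod: "e \<in> arcs G \<Longrightarrow> [reduce_mod G p f e = f e] (mod p)"
  by (simp add: reduce_mod_def)

lemma (in wf_digraph) is_dual_flow_reduce_mod:
  assumes "p > 0" and "\<forall>e\<in>arcs G. [f e = coboundary G \<pi> e] (mod p)"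
  shows "is_dual_flow G p (reduce_mod G p f)"
proof -
  have "reduce_mod G p f \<in> Zp_maps G p"
    using \<open>p > 0\<close> by (simp add: reduce_mod_def Zp_maps_def)
  then show ?thesis
    using assms(2) cong_reduce_mod unfolding is_dual_flow_iff_potential by (metis cong_trans)
qed

lemma (in wf_digraph) is_dual_flow_reduce_mod_add:
  assumes "p > 0" "is_dual_flow G p \<phi>" "is_dual_flow G p \<phi>'"
  shows "is_dual_flow G p (reduce_mod G p (\<lambda>e. \<phi> e + \<phi>' e))"
proof -
  obtain \<pi> \<pi>' where "\<forall>e\<in>arcs G. [\<phi> e = coboundary G \<pi> e] (mod p)"
      "\<forall>e\<in>arcs G. [\<phi>' e = coboundary G \<pi>' e] (mod p)"
    using assms by (auto simp: is_dual_flow_iff_potential)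
  then have "\<forall>e\<in>arcs G. [\<phi> e + \<phi>' e = coboundary G \<pi> e + coboundary G \<pi>' e] (mod p)"
    by (simp add: cong_add)
  moreover have "coboundary G \<pi> e + coboundary G \<pi>' e = coboundary G (\<lambda>v. \<pi> v + \<pi>' v) e" for e
    by (simp add: coboundary_def)
  ultimately show ?thesis by (intro is_dual_flow_reduce_mod[OF \<open>p > 0\<close>]) simp
qed

subsection \<open>Flows as the orthogonal complement of the dual flows\<close>

definition excess :: "('a, 'b) pre_digraph \<Rightarrow> ('b \<Rightarrow> 'c::ab_group_add) \<Rightarrow> 'a \<Rightarrow> 'c" where
  "excess G k v = sum k (in_arcs G v) - sum k (out_arcs G v)"

lemma is_flow_iff_dvd_excess:
  "is_flow G p k \<longleftrightarrow> k \<in> Zp_maps G p \<and> (\<forall>v\<in>verts G. p dvd excess G k v)"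
  by (simp add: is_flow_def excess_def cong_0_iff)

lemma sum_mult_fibres:
  fixes k :: "'b \<Rightarrow> 'c::comm_semiring_0"
  assumes "finite A" "finite V" "h ` A \<subseteq> V"
  shows "(\<Sum>v\<in>V. \<pi> v * sum k {e \<in> A. h e = v}) = (\<Sum>e\<in>A. k e * \<pi> (h e))"
proof -
  have "(\<Sum>v\<in>V. \<pi> v * sum k {e \<in> A. h e = v}) = (\<Sum>v\<in>V. \<Sum>e\<in>{e \<in> A. h e = v}. k e * \<pi> (h e))"
    by (intro sum.cong) (auto simp: sum_distrib_left mult.commute)
  also have "\<dots> = (\<Sum>e\<in>A. k e * \<pi> (h e))" using assms by (rule sum.group)
  finally show ?thesis .
qed

lemma (in fin_digraph) sum_mult_coboundary:
  fixes k :: "'b \<Rightarrow> 'c::comm_ring"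
  shows "(\<Sum>e\<in>arcs G. k e * coboundary G \<pi> e) = (\<Sum>v\<in>verts G. \<pi> v * excess G k v)"
proof -
  have "(\<Sum>v\<in>verts G. \<pi> v * sum k (in_arcs G v)) = (\<Sum>e\<in>arcs G. k e * \<pi> (head G e))"
    "(\<Sum>v\<in>verts G. \<pi> v * sum k (out_arcs G v)) = (\<Sum>e\<in>arcs G. k e * \<pi> (tail G e))"
    unfolding in_arcs_def out_arcs_def by (intro sum_mult_fibres; auto)+
  then show ?thesis
    by (simp add: coboundary_def excess_def right_diff_distrib sum_subtractf)
qed

lemma (in fin_digraph) sum_mult_cong_excess:
  fixes k :: "'b \<Rightarrow> int"
  assumes "\<forall>e\<in>arcs G. [\<phi> e = coboundary G \<pi> e] (mod p)"
  shows "[(\<Sum>e\<in>arcs G. k e * \<phi> e) = (\<Sum>v\<in>verts G. \<pi> v * excess G k v)] (mod p)"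
  unfolding sum_mult_coboundary[symmetric] using assms by (intro cong_sum cong_mult) auto

theorem (in fin_digraph) is_flow_iff_orthogonal:
  assumes "p > 0" "k \<in> Zp_maps G p"
  shows "is_flow G p k \<longleftrightarrow> (\<forall>\<phi>. is_dual_flow G p \<phi> \<longrightarrow> p dvd (\<Sum>e\<in>arcs G. k e * \<phi> e))"
proof (intro iffI allI impI)
  fix \<phi> assume flow: "is_flow G p k" and "is_dual_flow G p \<phi>"
  then obtain \<pi> where "\<forall>e\<in>arcs G. [\<phi> e = coboundary G \<pi> e] (mod p)"
    by (auto simp: is_dual_flow_iff_potential)
  then have "[(\<Sum>e\<in>arcs G. k e * \<phi> e) = (\<Sum>v\<in>verts G. \<pi> v * excess G k v)] (mod p)"
    by (rule sum_mult_cong_excess)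
  moreover have "p dvd (\<Sum>v\<in>verts G. \<pi> v * excess G k v)"
    using flow by (intro dvd_sum dvd_mult) (simp add: is_flow_iff_dvd_excess)
  ultimately show "p dvd (\<Sum>e\<in>arcs G. k e * \<phi> e)" by (simp add: cong_dvd_iff)
next
  assume orth: "\<forall>\<phi>. is_dual_flow G p \<phi> \<longrightarrow> p dvd (\<Sum>e\<in>arcs G. k e * \<phi> e)"
  have "p dvd excess G k v" if v: "v \<in> verts G" for v
  proof -
    let ?\<pi> = "\<lambda>w. of_bool (w = v)"
    let ?\<phi> = "reduce_mod G p (coboundary G ?\<pi>)"
    have "p dvd (\<Sum>e\<in>arcs G. k e * ?\<phi> e)"
      using orth is_dual_flow_reduce_mod[OF \<open>p > 0\<close>, of "coboundary G ?\<pi>" ?\<pi>] by simp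
    moreover have "[(\<Sum>e\<in>arcs G. k e * ?\<phi> e) = (\<Sum>w\<in>verts G. ?\<pi> w * excess G k w)] (mod p)"
      by (intro sum_mult_cong_excess ballI cong_reduce_mod)
    moreover have "(\<Sum>w\<in>verts G. ?\<pi> w * excess G k w) = excess G k v" using v by simp
    ultimately show ?thesis by (simp add: cong_dvd_iff)
  qed
  then show "is_flow G p k" using assms by (simp add: is_flow_iff_dvd_excess)
qed

subsection \<open>Characters\<close>

lemma sum_eq_0_if_scaled:
  fixes f :: "'a \<Rightarrow> 'c::idom"
  assumes "finite A" "t ` A \<subseteq> A" "inj_on t A" "\<And>x. x \<in> A \<Longrightarrow> f (t x) = c * f x" "c \<noteq> 1"
  shows "sum f A = 0"
proof -
  have "t ` A = A" using assms by (intro endo_inj_surj)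
  then have "sum f A = sum (f \<circ> t) A"
    using sum.reindex[OF assms(3), of f] by simp
  also have "\<dots> = c * sum f A"
    using assms(4) by (simp add: sum_distrib_left)
  finally show ?thesis using \<open>c \<noteq> 1\<close> by simp
qed

lemma inj_on_add_mod: "inj_on (\<lambda>x. (x + a) mod p) {0..<p}" for p :: int
proof (rule inj_onI)
  fix x y assume "x \<in> {0..<p}" "y \<in> {0..<p}" "(x + a) mod p = (y + a) mod p"
  then have "[x = y] (mod p)" by (metis cong_add_rcancel cong_def)
  then show "x = y" using \<open>x \<in> _\<close> \<open>y \<in> _\<close> by (simp add: cong_def)
qed

definition unity_root :: "int \<Rightarrow> int \<Rightarrow> complex" where
  "unity_root p n = cis (2 * pi * of_int n / of_int p)"

lemma unity_root_0 [simp]: "unity_root p 0 = 1"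
  by (simp add: unity_root_def)

lemma unity_root_add: "unity_root p (m + n) = unity_root p m * unity_root p n"
  by (simp add: unity_root_def cis_mult algebra_simps add_divide_distrib)

lemma unity_root_sum: "unity_root p (sum f A) = (\<Prod>x\<in>A. unity_root p (f x))"
  by (induction A rule: infinite_finite_induct) (simp_all add: unity_root_add)

lemma unity_root_eq_1_iff:
  assumes "p > 0"
  shows "unity_root p n = 1 \<longleftrightarrow> p dvd n"
proof -
  have "unity_root p n = 1 \<longleftrightarrow> (\<exists>m. real_of_int n = of_int (p * m))"
    using assms by (simp add: unity_root_def cis_eq_1_iff field_simps)
  then show ?thesis by (simp only: of_int_eq_iff dvd_def)
qed

lemma unity_root_cong:
  assumes "p > 0" "[m = n] (mod p)"
  shows "unity_root p m = unity_root p n"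
proof -
  have "unity_root p m = unity_root p n * unity_root p (m - n)"
    by (simp flip: unity_root_add)
  moreover have "unity_root p (m - n) = 1"
    using assms by (simp add: unity_root_eq_1_iff cong_iff_dvd_diff)
  ultimately show ?thesis by simp
qed

lemma sum_unity_root:
  assumes "p > 0"
  shows "(\<Sum>k\<in>{0..<p}. unity_root p (k * n)) = of_int p * of_bool (p dvd n)"
proof (cases "p dvd n")
  case True
  then have "unity_root p (k * n) = 1" for k using assms by (simp add: unity_root_eq_1_iff)
  then show ?thesis using True assms by simp
next
  case False
  have "(\<Sum>k\<in>{0..<p}. unity_root p (k * n)) = 0"
  proof (rule sum_eq_0_if_scaled[OF _ _ inj_on_add_mod])
    show "unity_root p ((k + 1) mod p * n) = unity_root p n * unity_root p (k * n)" for k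
    proof -
      have "[(k + 1) mod p * n = n + k * n] (mod p)"
        using cong_mult[of "(k + 1) mod p" "k + 1" p n n] by (simp add: algebra_simps)
      from unity_root_cong[OF assms this] show ?thesis by (simp add: unity_root_add)
    qed
    show "unity_root p n \<noteq> 1" using False assms by (simp add: unity_root_eq_1_iff)
  qed (use assms in auto)
  then show ?thesis using False by simp
qed

lemma unity_root_inversion:
  assumes "p > 0" "x \<in> {0..<p}"
  shows "f x = (\<Sum>k\<in>{0..<p}.
    (\<Sum>a\<in>{0..<p}. f a * unity_root p (k * - a)) / of_int p * unity_root p (k * x))"
proof -
  have dvd_iff: "p dvd x - a \<longleftrightarrow> a = x" if "a \<in> {0..<p}" for a
    using that assms(2) by (metis mod_eq_dvd_iff mod_pos_pos_trivial atLeastLessThan_iff)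
  have product: "unity_root p (k * - a) * unity_root p (k * x) = unity_root p (k * (x - a))"
    for k a
    by (simp add: algebra_simps flip: unity_root_add)
  have "(\<Sum>k\<in>{0..<p}.
        (\<Sum>a\<in>{0..<p}. f a * unity_root p (k * - a)) / of_int p * unity_root p (k * x)) =
      (\<Sum>k\<in>{0..<p}. \<Sum>a\<in>{0..<p}. f a / of_int p * unity_root p (k * (x - a)))"
    by (simp add: sum_distrib_right sum_divide_distrib mult.assoc flip: product)
  also have "\<dots> = (\<Sum>a\<in>{0..<p}. f a / of_int p * (\<Sum>k\<in>{0..<p}. unity_root p (k * (x - a))))"
    by (subst sum.swap) (simp add: sum_distrib_left)
  also have "\<dots> = (\<Sum>a\<in>{0..<p}. f a * of_bool (a = x))"
    using assms(1) by (intro sum.cong) (simp_all add: sum_unity_root dvd_iff)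
  also have "\<dots> = f x" using assms(2) by simp
  finally show ?thesis by simp
qed

subsection \<open>Two spanning families of the functions of sum zero\<close>

definition spanned_on ::
    "'x set \<Rightarrow> 'b set \<Rightarrow> ('b \<Rightarrow> 'x \<Rightarrow> 'c::comm_semiring_1) \<Rightarrow> ('x \<Rightarrow> 'c) \<Rightarrow> bool" where
  "spanned_on X B g f \<longleftrightarrow> (\<exists>c. \<forall>x\<in>X. f x = (\<Sum>b\<in>B. c b * g b x))"

lemma ex_nonzero_sum_prod_if_spanned:
  fixes f :: "'i \<Rightarrow> 'x \<Rightarrow> 'c::comm_semiring_1"
  assumes "finite A" "finite B"
    and range: "D \<subseteq> A \<rightarrow> X"
    and spanned: "\<And>i. i \<in> I \<Longrightarrow> spanned_on X B g (f i)"
    and nonzero: "\<exists>i\<in>A \<rightarrow>\<^sub>E I. (\<Sum>\<phi>\<in>D. \<Prod>e\<in>A. f (i e) (\<phi> e)) \<noteq> 0"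
  shows "\<exists>b\<in>A \<rightarrow>\<^sub>E B. (\<Sum>\<phi>\<in>D. \<Prod>e\<in>A. g (b e) (\<phi> e)) \<noteq> 0"
proof (rule ccontr)
  assume "\<not> ?thesis"
  then have zero: "(\<Sum>\<phi>\<in>D. \<Prod>e\<in>A. g (b e) (\<phi> e)) = 0" if "b \<in> A \<rightarrow>\<^sub>E B" for b
    using that by blast
  obtain i where i: "i \<in> A \<rightarrow>\<^sub>E I" "(\<Sum>\<phi>\<in>D. \<Prod>e\<in>A. f (i e) (\<phi> e)) \<noteq> 0"
    using nonzero by blast
  obtain c where c: "\<And>j x. j \<in> I \<Longrightarrow> x \<in> X \<Longrightarrow> f j x = (\<Sum>b\<in>B. c j b * g b x)"
    using spanned unfolding spanned_on_def by metis
  have "(\<Sum>\<phi>\<in>D. \<Prod>e\<in>A. f (i e) (\<phi> e)) = (\<Sum>\<phi>\<in>D. \<Prod>e\<in>A. \<Sum>b\<in>B. c (i e) b * g b (\<phi> e))"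
    using i(1) range by (intro sum.cong prod.cong refl c) fastforce+
  also have "\<dots> = (\<Sum>\<phi>\<in>D. \<Sum>b\<in>A \<rightarrow>\<^sub>E B. (\<Prod>e\<in>A. c (i e) (b e)) * (\<Prod>e\<in>A. g (b e) (\<phi> e)))"
    using assms(1,2) by (simp add: prod_sum_PiE prod.distrib)
  also have "\<dots> = (\<Sum>b\<in>A \<rightarrow>\<^sub>E B. (\<Prod>e\<in>A. c (i e) (b e)) * (\<Sum>\<phi>\<in>D. \<Prod>e\<in>A. g (b e) (\<phi> e)))"
    by (subst sum.swap) (simp add: sum_distrib_left)
  also have "\<dots> = 0" by (simp add: zero)
  finally show False using i(2) by contradiction
qed

lemma spanned_on_nontrivial_unity_roots:
  assumes "p > 0" "(\<Sum>a\<in>{0..<p}. f a) = 0"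
  shows "spanned_on {0..<p} {1..<p} (\<lambda>k x. unity_root p (k * x)) f"
  unfolding spanned_on_def
proof (intro exI ballI)
  have split: "{0..<p} = insert 0 {1..<p}" using assms(1) by auto
  let ?c = "\<lambda>k. (\<Sum>a\<in>{0..<p}. f a * unity_root p (k * - a)) / of_int p"
  fix x assume "x \<in> {0..<p}"
  with assms(1) have "f x = (\<Sum>k\<in>{0..<p}. ?c k * unity_root p (k * x))"
    by (rule unity_root_inversion)
  also have "\<dots> = ?c 0 + (\<Sum>k\<in>{1..<p}. ?c k * unity_root p (k * x))"
    unfolding split by (subst sum.insert) auto
  also have "?c 0 = 0" using assms(2) by simp
  finally show "f x = (\<Sum>k\<in>{1..<p}. ?c k * unity_root p (k * x))" by simp
qed

definition delta_diff :: "int \<Rightarrow> int \<Rightarrow> int \<Rightarrow> 'c::comm_ring_1" where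
  "delta_diff p a x = of_bool (x = a) - of_bool (x = p - 1)"

lemma sum_delta_diff:
  assumes "a \<in> {0..<p}"
  shows "(\<Sum>x\<in>{0..<p}. delta_diff p a x) = 0"
  using assms by (simp add: delta_diff_def sum_subtractf)

lemma spanned_on_delta_diffs:
  fixes f :: "int \<Rightarrow> 'c::comm_ring_1"
  assumes "p > 0" "(\<Sum>a\<in>{0..<p}. f a) = 0"
  shows "spanned_on {0..<p} {0..p - 2} (delta_diff p) f"
  unfolding spanned_on_def
proof (intro exI ballI)
  fix x assume x: "x \<in> {0..<p}"
  have "f x = (\<Sum>a\<in>{0..<p}. f a * of_bool (x = a)) - (\<Sum>a\<in>{0..<p}. f a) * of_bool (x = p - 1)"
    using x assms(2) by simp
  also have "\<dots> = (\<Sum>a\<in>{0..<p}. f a * delta_diff p a x)"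
    by (simp add: delta_diff_def right_diff_distrib sum_subtractf sum_distrib_right)
  also have "\<dots> = (\<Sum>a\<in>{0..p - 2}. f a * delta_diff p a x)"
    using assms(1) by (intro sum.mono_neutral_right) (auto simp: delta_diff_def)
  finally show "f x = (\<Sum>a\<in>{0..p - 2}. f a * delta_diff p a x)" .
qed

subsection \<open>Sums over dual flows\<close>

abbreviation dual_flows :: "('a, 'b) pre_digraph \<Rightarrow> int \<Rightarrow> ('b \<Rightarrow> int) set" where
  "dual_flows G p \<equiv> {\<phi>. is_dual_flow G p \<phi>}"

lemma dual_flows_subset_Zp_maps: "dual_flows G p \<subseteq> Zp_maps G p"
  by (auto simp: is_dual_flow_def)

lemma (in fin_digraph) finite_dual_flows: "finite (dual_flows G p)"
  using dual_flows_subset_Zp_maps by (rule finite_subset) (simp add: Zp_maps_def finite_PiE)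

lemma inj_on_reduce_mod_add: "inj_on (\<lambda>\<phi>. reduce_mod G p (\<lambda>e. \<phi> e + \<phi>\<^sub>0 e)) (Zp_maps G p)"
proof (rule inj_onI)
  fix \<phi> \<phi>'
  assume maps: "\<phi> \<in> Zp_maps G p" "\<phi>' \<in> Zp_maps G p"
    and eq: "reduce_mod G p (\<lambda>e. \<phi> e + \<phi>\<^sub>0 e) = reduce_mod G p (\<lambda>e. \<phi>' e + \<phi>\<^sub>0 e)"
  have "\<phi> e = \<phi>' e" if "e \<in> arcs G" for e
  proof (rule inj_onD[OF inj_on_add_mod])
    show "(\<phi> e + \<phi>\<^sub>0 e) mod p = (\<phi>' e + \<phi>\<^sub>0 e) mod p"
      using fun_cong[OF eq, of e] that by (simp add: reduce_mod_def)
  qed (use maps that in \<open>auto simp: Zp_maps_def\<close>)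
  then show "\<phi> = \<phi>'" using maps by (auto simp: Zp_maps_def intro: PiE_ext)
qed

lemma (in fin_digraph) sum_dual_flows_unity_root_eq_0:
  assumes "p > 0" "is_dual_flow G p \<phi>\<^sub>0" "\<not> p dvd (\<Sum>e\<in>arcs G. k e * \<phi>\<^sub>0 e)"
  shows "(\<Sum>\<phi>\<in>dual_flows G p. unity_root p (\<Sum>e\<in>arcs G. k e * \<phi> e)) = 0"
proof (rule sum_eq_0_if_scaled)
  let ?translate = "\<lambda>\<phi>. reduce_mod G p (\<lambda>e. \<phi> e + \<phi>\<^sub>0 e)"
  show "?translate ` dual_flows G p \<subseteq> dual_flows G p"
    using is_dual_flow_reduce_mod_add assms(1,2) by blast
  show "inj_on ?translate (dual_flows G p)"
    using inj_on_reduce_mod_add dual_flows_subset_Zp_maps by (rule inj_on_subset)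
  show "unity_root p (\<Sum>e\<in>arcs G. k e * ?translate \<phi> e) =
      unity_root p (\<Sum>e\<in>arcs G. k e * \<phi>\<^sub>0 e) * unity_root p (\<Sum>e\<in>arcs G. k e * \<phi> e)" for \<phi>
  proof -
    have "[(\<Sum>e\<in>arcs G. k e * ?translate \<phi> e) = (\<Sum>e\<in>arcs G. k e * (\<phi> e + \<phi>\<^sub>0 e))] (mod p)"
      by (intro cong_sum cong_mult cong_refl cong_reduce_mod)
    from unity_root_cong[OF assms(1) this] show ?thesis
      by (simp add: distrib_left sum.distrib unity_root_add)
  qed
  show "unity_root p (\<Sum>e\<in>arcs G. k e * \<phi>\<^sub>0 e) \<noteq> 1"
    using assms(1,3) by (simp add: unity_root_eq_1_iff)
qed (rule finite_dual_flows)

lemma (in fin_digraph) is_flow_iff_sum_unity_root_nonzero: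
  assumes "p > 0" "k \<in> Zp_maps G p"
  shows "is_flow G p k \<longleftrightarrow>
    (\<Sum>\<phi>\<in>dual_flows G p. \<Prod>e\<in>arcs G. unity_root p (k e * \<phi> e)) \<noteq> 0"
proof (cases "is_flow G p k")
  case True
  then have "unity_root p (\<Sum>e\<in>arcs G. k e * \<phi> e) = 1" if "\<phi> \<in> dual_flows G p" for \<phi>
    using that assms by (simp add: is_flow_iff_orthogonal unity_root_eq_1_iff)
  moreover have "dual_flows G p \<noteq> {}"
    using is_dual_flow_reduce_mod[OF assms(1), of "coboundary G \<pi>" \<pi> for \<pi>] by auto
  ultimately show ?thesis using True finite_dual_flows by (simp flip: unity_root_sum)
next
  case False
  then obtain \<phi>\<^sub>0 where "is_dual_flow G p \<phi>\<^sub>0" "\<not> p dvd (\<Sum>e\<in>arcs G. k e * \<phi>\<^sub>0 e)"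
    using assms by (auto simp: is_flow_iff_orthogonal)
  then show ?thesis
    using False sum_dual_flows_unity_root_eq_0[OF assms(1)] by (simp flip: unity_root_sum)
qed

lemma (in fin_digraph) ex_nowhere_zero_flow_iff:
  assumes "p > 0"
  shows "(\<exists>k. is_flow G p k \<and> nowhere_zero G k) \<longleftrightarrow>
    (\<exists>k\<in>arcs G \<rightarrow>\<^sub>E {1..<p}.
      (\<Sum>\<phi>\<in>dual_flows G p. \<Prod>e\<in>arcs G. unity_root p (k e * \<phi> e)) \<noteq> 0)"
proof -
  have "k \<in> Zp_maps G p \<and> nowhere_zero G k \<longleftrightarrow> k \<in> arcs G \<rightarrow>\<^sub>E {1..<p}" for k
    by (force simp: Zp_maps_def nowhere_zero_def PiE_iff)
  moreover have "is_flow G p k \<Longrightarrow> k \<in> Zp_maps G p" for k by (simp add: is_flow_def)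
  ultimately show ?thesis
    using is_flow_iff_sum_unity_root_nonzero[OF assms] by blast
qed

lemma prod_delta_diff:
  assumes "finite A" "\<And>e. e \<in> A \<Longrightarrow> \<psi> e \<noteq> p - 1"
  shows "(\<Prod>e\<in>A. delta_diff p (\<psi> e) (\<phi> e) :: 'c::comm_ring_1) =
    (if \<forall>e\<in>A. \<phi> e \<in> {\<psi> e, p - 1} then (- 1) ^ card {e \<in> A. \<phi> e = p - 1} else 0)"
proof (cases "\<forall>e\<in>A. \<phi> e \<in> {\<psi> e, p - 1}")
  case True
  have "(\<Prod>e\<in>A. delta_diff p (\<psi> e) (\<phi> e) :: 'c) = (\<Prod>e\<in>A. if \<phi> e = p - 1 then - 1 else 1)"
    using True assms(2) by (intro prod.cong) (force simp: delta_diff_def)+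
  also have "\<dots> = (- 1) ^ card {e \<in> A. \<phi> e = p - 1}"
    using assms(1) by (simp add: prod.If_cases Int_def)
  finally show ?thesis using True by simp
next
  case False
  then obtain e where "e \<in> A" "delta_diff p (\<psi> e) (\<phi> e) = (0 :: 'c)"
    by (auto simp: delta_diff_def)
  then have "(\<Prod>e\<in>A. delta_diff p (\<psi> e) (\<phi> e) :: 'c) = 0"
    using assms(1) by (intro prod_zero) auto
  then show ?thesis by (subst if_not_P[OF False])
qed

lemma (in fin_digraph) sum_dual_flows_delta_diff:
  assumes "\<psi> \<in> arcs G \<rightarrow>\<^sub>E {0..p - 2}"
  shows "(\<Sum>\<phi>\<in>dual_flows G p. \<Prod>e\<in>arcs G. delta_diff p (\<psi> e) (\<phi> e) :: 'c::comm_ring_1) =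
    of_nat (card {\<phi>. is_dual_flow G p \<phi> \<and> conformal G p \<psi> \<phi> \<and> even_map G p \<phi>}) -
    of_nat (card {\<phi>. is_dual_flow G p \<phi> \<and> conformal G p \<psi> \<phi> \<and> odd_map G p \<phi>})"
proof -
  have "\<psi> e \<noteq> p - 1" if "e \<in> arcs G" for e
    using assms that by (fastforce simp: PiE_iff)
  then have "(\<Prod>e\<in>arcs G. delta_diff p (\<psi> e) (\<phi> e) :: 'c) =
      of_bool (conformal G p \<psi> \<phi> \<and> even_map G p \<phi>) -
      of_bool (conformal G p \<psi> \<phi> \<and> odd_map G p \<phi>)" for \<phi>
    by (subst prod_delta_diff) (auto simp: conformal_def even_map_def)
  then show ?thesis
    using finite_dual_flows[of p] by (simp add: sum_subtractf flip: Collect_conj_eq)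
qed

lemma (in fin_digraph) ex_nonzero_sum_exchange:
  assumes "p > 0"
  shows "(\<exists>k\<in>arcs G \<rightarrow>\<^sub>E {1..<p}.
      (\<Sum>\<phi>\<in>dual_flows G p. \<Prod>e\<in>arcs G. unity_root p (k e * \<phi> e)) \<noteq> 0) \<longleftrightarrow>
    (\<exists>\<psi>\<in>arcs G \<rightarrow>\<^sub>E {0..p - 2}.
      (\<Sum>\<phi>\<in>dual_flows G p. \<Prod>e\<in>arcs G. delta_diff p (\<psi> e) (\<phi> e) :: complex) \<noteq> 0)"
    (is "?characters \<longleftrightarrow> ?deltas")
proof
  have range: "dual_flows G p \<subseteq> arcs G \<rightarrow> {0..<p}"
    using dual_flows_subset_Zp_maps by (fastforce simp: Zp_maps_def)
  show ?deltas if ?characters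
  proof (rule ex_nonzero_sum_prod_if_spanned
      [where f = "\<lambda>k x. unity_root p (k * x)", OF _ _ range _ that])
    fix k assume "k \<in> {1..<p}"
    then have "\<not> p dvd k" by (simp add: zdvd_not_zless)
    then have "(\<Sum>a\<in>{0..<p}. unity_root p (k * a)) = 0"
      using sum_unity_root[OF assms, of k] by (simp add: mult.commute)
    then show "spanned_on {0..<p} {0..p - 2} (delta_diff p) (\<lambda>x. unity_root p (k * x))"
      by (rule spanned_on_delta_diffs[OF assms])
  qed auto
  show ?characters if ?deltas
  proof (rule ex_nonzero_sum_prod_if_spanned
      [where g = "\<lambda>k x. unity_root p (k * x)", OF _ _ range _ that])
    fix a assume "a \<in> {0..p - 2}"
    then have "(\<Sum>x\<in>{0..<p}. delta_diff p a x :: complex) = 0" by (intro sum_delta_diff) auto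
    then show "spanned_on {0..<p} {1..<p} (\<lambda>k x. unity_root p (k * x)) (delta_diff p a)"
      by (rule spanned_on_nontrivial_unity_roots[OF assms])
  qed auto
qed

theorem theorem1p2:
  fixes G :: "('a, 'b) pre_digraph" and p :: int
  assumes "fin_digraph G" and "p \<ge> 2"
  shows "(\<exists>\<phi>. is_flow G p \<phi> \<and> nowhere_zero G \<phi>) \<longleftrightarrow>
    (\<exists>\<psi> \<in> arcs G \<rightarrow>\<^sub>E {0..p - 2}.
       card {\<phi>. is_dual_flow G p \<phi> \<and> conformal G p \<psi> \<phi> \<and> even_map G p \<phi>}
       \<noteq> card {\<phi>. is_dual_flow G p \<phi> \<and> conformal G p \<psi> \<phi> \<and> odd_map G p \<phi>})"
proof -
  interpret fin_digraph G by fact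
  have "p > 0" using assms(2) by simp
  then have "(\<exists>\<phi>. is_flow G p \<phi> \<and> nowhere_zero G \<phi>) \<longleftrightarrow>
    (\<exists>\<psi>\<in>arcs G \<rightarrow>\<^sub>E {0..p - 2}.
      (\<Sum>\<phi>\<in>dual_flows G p. \<Prod>e\<in>arcs G. delta_diff p (\<psi> e) (\<phi> e) :: complex) \<noteq> 0)"
    by (simp only: ex_nowhere_zero_flow_iff ex_nonzero_sum_exchange)
  also have "\<dots> \<longleftrightarrow> (\<exists>\<psi> \<in> arcs G \<rightarrow>\<^sub>E {0..p - 2}.
       card {\<phi>. is_dual_flow G p \<phi> \<and> conformal G p \<psi> \<phi> \<and> even_map G p \<phi>}
       \<noteq> card {\<phi>. is_dual_flow G p \<phi> \<and> conformal G p \<psi> \<phi> \<and> odd_map G p \<phi>})"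
    by (intro bex_cong refl) (simp add: sum_dual_flows_delta_diff)
  finally show ?thesis .
qed

end
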